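(* Consider the LSTM network with input $u\in\mathbb{R}^{n_u}$, state $\chi=(x,\xi)\in\mathbb{R}^{n_x}\times\mathbb{R}^{n_x}$ and output $y\in\mathbb{R}^{n_y}$: \[ \begin{aligned} x^+ &= \sigma_g(W_f u + U_f \xi + b_f)\circ x + \sigma_g(W_i u + U_i \xi + b_i)\circ \sigma_c(W_c u + U_c \xi + b_c),\\ \xi^+ &= \sigma_g(W_o u + U_o \xi + b_o)\circ \sigma_c(x^+),\\ y &= C\xi + b_y, \end{aligned} \] with inputs restricted to $\mathcal{U}=[-u_{\max},u_{\max}]^{n_u}$. Define \[ A=\begin{bmatrix}\bar{\sigma}_g^f & \bar{\sigma}_g^i\|U_c\|\\ \bar{\sigma}_g^o\bar{\sigma}_g^f & \bar{\sigma}_g^o\bar{\sigma}_g^i\|U_c\|\end{bmatrix}. \] If $\rho(A)<1$, then the network is input-to-state stable (ISS) with respect to the input $u$ and the bias $b_c$: there exist $\beta\in\mathcal{KL}$ and $\gamma_v,\gamma_b\in\mathcal{K}_\infty$ such that for every $k\in\mathbb{Z}_{\ge 0}$, every initial state $\chi_0\in\mathcal{X}$, and every input sequence $u(0),u(1),\dots$ with $u(\tau)\in\mathcal{U}$, \[ \|\chi(k)\|\le \beta(\|\chi_0\|,k)+\gamma_v\big(\max_{h\ge0}\|u(h)\|\big)+\gamma_b(\|b_c\|). \]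
   Context: $\sigma_g(t)=1/(1+e^{-t})$ and $\sigma_c(t)=\tanh(t)$ are applied entrywise; $\circ$ is the entrywise (Hadamard) product. $W_\star\in\mathbb{R}^{n_x\times n_u}$, $U_\star\in\mathbb{R}^{n_x\times n_x}$ ($\star\in\{f,i,o,c\}$), $C\in\mathbb{R}^{n_y\times n_x}$, $b_\star\in\mathbb{R}^{n_x}$, $b_y\in\mathbb{R}^{n_y}$. $\|\cdot\|$ is the Euclidean norm for vectors and the induced 2-norm for matrices; $\|\cdot\|_\infty$ is the induced $\infty$-norm (maximum absolute row sum); $\rho(\cdot)$ is the spectral radius. For $\star\in\{f,i,o\}$, $\bar{\sigma}_g^\star=\sigma_g\big(\|[\,W_\star u_{\max}\ \ U_\star\ \ b_\star\,]\|_\infty\big)$, where $[\cdot\ \cdot\ \cdot]$ is horizontal concatenation; $\bar{\sigma}_c^c=\sigma_c\big(\|[\,W_c u_{\max}\ \ U_c\ \ b_c\,]\|_\infty\big)$. The state set is $\mathcal{X}=\{(x,\xi): |x_{(j)}|\le \bar{\sigma}_g^i\bar{\sigma}_c^c/(1-\bar{\sigma}_g^f),\ \xi_{(j)}\in(-1,1),\ j=1,\dots,n_x\}$. A $\mathcal{K}$ function is continuous, strictly increasing, zero at zero; $\mathcal{K}_\infty$ additionally unbounded; $\beta\in\mathcal{KL}$ means $\beta(\cdot,k)\in\mathcal{K}$ for each $k$, $\beta(s,\cdot)$ strictly decreasing with $\beta(s,k)\to0$ as $k\to\infty$ for $s>0$. *)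

theory Defs
  imports "HOL-Analysis.Analysis"
begin

text \<open>Logistic sigmoid (gate activation).\<close>
definition sigmoid :: "real \<Rightarrow> real" where
  "sigmoid t = 1 / (1 + exp (- t))"

text \<open>Entrywise application and Hadamard product.\<close>
definition vmap :: "(real \<Rightarrow> real) \<Rightarrow> real ^ 'n \<Rightarrow> real ^ 'n" where
  "vmap f v = (\<chi> i. f (v $ i))"

definition hadamard :: "real ^ 'n \<Rightarrow> real ^ 'n \<Rightarrow> real ^ 'n" (infixl "\<circ>\<^sub>H" 70) where
  "a \<circ>\<^sub>H b = (\<chi> i. a $ i * b $ i)"

text \<open>Induced 2-norm of a matrix (Euclidean norm on vectors).\<close>
definition mat_norm2 :: "real ^ 'm ^ 'n \<Rightarrow> real" where
  "mat_norm2 M = onorm (\<lambda>v. M *v v)"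

text \<open>Induced \<infinity>-norm (maximum absolute row sum) of the horizontal concatenation
  [W * umax, U, b] of the matrix W scaled by the scalar umax, the matrix U and the column b.\<close>
definition inf_norm_concat ::
  "real ^ 'u ^ 'x \<Rightarrow> real \<Rightarrow> real ^ 'x ^ 'x \<Rightarrow> real ^ 'x \<Rightarrow> real" where
  "inf_norm_concat W umax U b =
     Max (range (\<lambda>i. (\<Sum>j\<in>UNIV. \<bar>W $ i $ j * umax\<bar>) + (\<Sum>j\<in>UNIV. \<bar>U $ i $ j\<bar>) + \<bar>b $ i\<bar>))"

text \<open>Spectral radius of a real square matrix: largest modulus of its (complex) eigenvalues,
  i.e. of the roots of the characteristic polynomial.\<close>
definition spectral_radius :: "real ^ 'n ^ 'n \<Rightarrow> real" where
  "spectral_radius A =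
     Max {cmod z | z. det ((mat z :: complex ^ 'n ^ 'n) - (\<chi> i j. complex_of_real (A $ i $ j))) = 0}"

text \<open>Comparison functions (on the domain [0,\<infinity>)).\<close>
definition class_K :: "(real \<Rightarrow> real) \<Rightarrow> bool" where
  "class_K f \<longleftrightarrow> continuous_on {0..} f \<and> strict_mono_on {0..} f \<and> f 0 = 0"

definition class_Kinf :: "(real \<Rightarrow> real) \<Rightarrow> bool" where
  "class_Kinf f \<longleftrightarrow> class_K f \<and> (\<forall>M. \<exists>s\<ge>0. f s > M)"

definition class_KL :: "(real \<Rightarrow> nat \<Rightarrow> real) \<Rightarrow> bool" where
  "class_KL \<beta> \<longleftrightarrow> (\<forall>k. class_K (\<lambda>s. \<beta> s k)) \<and>
     (\<forall>s>0. (\<forall>k1 k2. k1 < k2 \<longrightarrow> \<beta> s k2 < \<beta> s k1) \<and> (\<lambda>k. \<beta> s k) \<longlonglongrightarrow> 0)"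

text \<open>LSTM parameters (the output map C, b_y plays no role in the ISS claim).\<close>
record ('u, 'x) lstm =
  Wf :: "real ^ 'u ^ 'x"  Wi :: "real ^ 'u ^ 'x"  Wo :: "real ^ 'u ^ 'x"  Wc :: "real ^ 'u ^ 'x"
  Uf :: "real ^ 'x ^ 'x"  Ui :: "real ^ 'x ^ 'x"  Uo :: "real ^ 'x ^ 'x"  Uc :: "real ^ 'x ^ 'x"
  bf :: "real ^ 'x"  bi :: "real ^ 'x"  bo :: "real ^ 'x"  bc :: "real ^ 'x"

text \<open>One step of the LSTM state equation, state \<chi> = (x, \<xi>).\<close>
definition lstm_step ::
  "('u::finite, 'x::finite) lstm \<Rightarrow> real ^ 'u \<Rightarrow> (real ^ 'x) \<times> (real ^ 'x) \<Rightarrow> (real ^ 'x) \<times> (real ^ 'x)" where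
  "lstm_step N u s =
    (let x = fst s; \<xi> = snd s;
         x' = vmap sigmoid (Wf N *v u + Uf N *v \<xi> + bf N) \<circ>\<^sub>H x
              + vmap sigmoid (Wi N *v u + Ui N *v \<xi> + bi N) \<circ>\<^sub>H vmap tanh (Wc N *v u + Uc N *v \<xi> + bc N);
         \<xi>' = vmap sigmoid (Wo N *v u + Uo N *v \<xi> + bo N) \<circ>\<^sub>H vmap tanh x'
     in (x', \<xi>'))"

text \<open>State trajectory \<chi>(k) from initial state \<chi>0 under input sequence u.\<close>
primrec lstm_traj ::
  "('u::finite, 'x::finite) lstm \<Rightarrow> (nat \<Rightarrow> real ^ 'u) \<Rightarrow> (real ^ 'x) \<times> (real ^ 'x) \<Rightarrow> nat \<Rightarrow> (real ^ 'x) \<times> (real ^ 'x)" where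
  "lstm_traj N u s0 0 = s0"
| "lstm_traj N u s0 (Suc k) = lstm_step N (u k) (lstm_traj N u s0 k)"

text \<open>Gate bounds \<bar>\<sigma>\<close>
definition sbar_f :: "('u::finite, 'x::finite) lstm \<Rightarrow> real \<Rightarrow> real" where
  "sbar_f N umax = sigmoid (inf_norm_concat (Wf N) umax (Uf N) (bf N))"
definition sbar_i :: "('u::finite, 'x::finite) lstm \<Rightarrow> real \<Rightarrow> real" where
  "sbar_i N umax = sigmoid (inf_norm_concat (Wi N) umax (Ui N) (bi N))"
definition sbar_o :: "('u::finite, 'x::finite) lstm \<Rightarrow> real \<Rightarrow> real" where
  "sbar_o N umax = sigmoid (inf_norm_concat (Wo N) umax (Uo N) (bo N))"
definition sbar_c :: "('u::finite, 'x::finite) lstm \<Rightarrow> real \<Rightarrow> real" where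
  "sbar_c N umax = tanh (inf_norm_concat (Wc N) umax (Uc N) (bc N))"

text \<open>Input set U and state set X.\<close>
definition input_set :: "real \<Rightarrow> (real ^ 'u) set" where
  "input_set umax = {u. \<forall>j. \<bar>u $ j\<bar> \<le> umax}"

definition state_set :: "('u::finite, 'x::finite) lstm \<Rightarrow> real \<Rightarrow> ((real ^ 'x) \<times> (real ^ 'x)) set" where
  "state_set N umax = {(x, \<xi>). \<forall>j.
      \<bar>x $ j\<bar> \<le> sbar_i N umax * sbar_c N umax / (1 - sbar_f N umax) \<and> -1 < \<xi> $ j \<and> \<xi> $ j < 1}"

text \<open>The 2x2 matrix A.\<close>
definition iss_matrix :: "('u::finite, 'x::finite) lstm \<Rightarrow> real \<Rightarrow> real ^ 2 ^ 2" where
  "iss_matrix N umax =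
     vector [vector [sbar_f N umax, sbar_i N umax * mat_norm2 (Uc N)],
             vector [sbar_o N umax * sbar_f N umax, sbar_o N umax * sbar_i N umax * mat_norm2 (Uc N)]]"

end

theory Submission
  imports Defs
begin

text \<open>The hidden state \<xi> always lies in the open unit cube, so each gate is bounded entrywise
  by its constant \<sigma>-bar, and \<bar>tanh t\<bar> \<le> \<bar>t\<bar>. Hence a(k) = \<parallel>x(k)\<parallel> and b(k) = \<parallel>\<xi>(k)\<parallel> satisfy
  the cascade a(k+1) \<le> \<sigma>f a(k) + \<sigma>i \<parallel>Uc\<parallel> b(k) + w, b(k+1) \<le> \<sigma>o a(k+1), where w collects
  the input and bias terms; A is the comparison matrix of this cascade. A has rank one, so
  \<rho>(A) is its nonzero eigenvalue \<lambda> = \<sigma>f + \<sigma>o \<sigma>i \<parallel>Uc\<parallel>, and r = \<sigma>f a + \<sigma>i \<parallel>Uc\<parallel> b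
  satisfies r(k+1) \<le> \<lambda> (r(k) + w). For \<lambda> < 1 the state therefore decays like \<lambda>^k up to
  a term linear in the input bound and in \<parallel>bc\<parallel>.\<close>

lemma abs_tanh_le_abs: "\<bar>tanh x\<bar> \<le> \<bar>x :: real\<bar>"
proof -
  have "tanh x \<le> x" if "0 \<le> x" for x :: real
  proof -
    have "0 - tanh 0 \<le> x - tanh x"
    proof (rule DERIV_nonneg_imp_nondecreasing[OF that])
      fix t :: real
      have "cosh t \<noteq> 0"
        by (metis cosh_real_pos less_irrefl)
      then have "((\<lambda>t. t - tanh t) has_real_derivative (1 - (1 - tanh t ^ 2) * 1)) (at t)"
        by (intro derivative_intros) auto
      then show "\<exists>y. ((\<lambda>t. t - tanh t) has_real_derivative y) (at t) \<and> 0 \<le> y"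
        by force
    qed
    then show ?thesis
      by simp
  qed
  then show ?thesis
    by (metis abs_ge_zero tanh_real_abs)
qed

lemma sigmoid_pos: "0 < sigmoid t"
  unfolding sigmoid_def by (simp add: add_pos_pos)

lemma sigmoid_less_1: "sigmoid t < 1"
  unfolding sigmoid_def by (simp add: add_pos_pos)

lemma sigmoid_mono: "s \<le> t \<Longrightarrow> sigmoid s \<le> sigmoid t"
  unfolding sigmoid_def by (simp add: frac_le add_pos_pos)

lemma norm_vmap_tanh_le: "norm (vmap tanh v) \<le> norm (v :: real ^ 'n)"
  by (rule norm_le_componentwise_cart) (simp add: vmap_def abs_tanh_le_abs)

lemma norm_hadamard_le:
  assumes "\<And>j. \<bar>g $ j\<bar> \<le> c"
  shows "norm (g \<circ>\<^sub>H v) \<le> c * norm (v :: real ^ 'n)"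
proof -
  have "\<bar>c\<bar> = c"
    using assms[of undefined] by simp
  have "norm (g \<circ>\<^sub>H v) \<le> norm (c *\<^sub>R v)"
    by (rule norm_le_componentwise_cart)
      (use assms \<open>\<bar>c\<bar> = c\<close> in \<open>auto simp: hadamard_def abs_mult intro: mult_right_mono\<close>)
  with \<open>\<bar>c\<bar> = c\<close> show ?thesis
    by simp
qed

lemma mat_norm2_nonneg: "0 \<le> mat_norm2 M"
  unfolding mat_norm2_def by (simp add: onorm_pos_le)

lemma norm_matrix_vector_mult_le: "norm (M *v v) \<le> mat_norm2 M * norm v"
  unfolding mat_norm2_def by (rule onorm[OF matrix_vector_mul_bounded_linear])

lemma spectral_radius_rank_one_2x2:
  fixes a b c :: real
  shows "spectral_radius (vector [vector [a, b], vector [c * a, c * b]] :: real ^ 2 ^ 2) = \<bar>a + c * b\<bar>"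
proof -
  let ?A = "vector [vector [a, b], vector [c * a, c * b]] :: real ^ 2 ^ 2"
  define l where "l = a + c * b"
  have "det ((mat z :: complex ^ 2 ^ 2) - (\<chi> i j. complex_of_real (?A $ i $ j)))
      = z * (z - complex_of_real l)" for z
    by (simp add: det_2 mat_def l_def algebra_simps)
  then have "{cmod z | z. det ((mat z :: complex ^ 2 ^ 2) - (\<chi> i j. complex_of_real (?A $ i $ j))) = 0}
      = {0, \<bar>l\<bar>}"
    by auto (metis norm_of_real)
  then show ?thesis
    unfolding spectral_radius_def l_def by simp
qed

text \<open>l w / (1 - l) is the fixed point of r \<mapsto> l (r + w).\<close>

lemma affine_contraction_bound:
  fixes r :: "nat \<Rightarrow> real"
  assumes "0 \<le> l" "l < 1" "0 \<le> w" and step: "\<And>k. r (Suc k) \<le> l * (r k + w)"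
  shows "r k \<le> l ^ k * r 0 + l * w / (1 - l)"
proof (induction k)
  case 0
  show ?case
    using assms by simp
next
  case (Suc k)
  have "r (Suc k) \<le> l * (l ^ k * r 0 + l * w / (1 - l) + w)"
    using step[of k] Suc.IH \<open>0 \<le> l\<close> by (meson add_right_mono mult_left_mono order.trans)
  also have "\<dots> = l ^ Suc k * r 0 + l * w / (1 - l)"
    using \<open>l < 1\<close> by (simp add: field_simps)
  finally show ?case .
qed

lemma cascade_combination_bound:
  fixes a b :: "nat \<Rightarrow> real"
  assumes "0 \<le> g" "0 \<le> w" and l: "l = f + g * h" "0 \<le> l" "l < 1"
    and a_step: "\<And>k. a (Suc k) \<le> f * a k + g * b k + w"
    and b_step: "\<And>k. b (Suc k) \<le> h * a (Suc k)"
  shows "f * a k + g * b k \<le> l ^ k * (f * a 0 + g * b 0) + l * w / (1 - l)"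
proof (rule affine_contraction_bound[where r = "\<lambda>k. f * a k + g * b k", OF l(2,3) \<open>0 \<le> w\<close>])
  fix k
  have "g * b (Suc k) \<le> g * h * a (Suc k)"
    using mult_left_mono[OF b_step \<open>0 \<le> g\<close>] by (simp add: mult.assoc)
  then have "f * a (Suc k) + g * b (Suc k) \<le> l * a (Suc k)"
    unfolding l(1) by (simp add: distrib_right)
  also have "\<dots> \<le> l * (f * a k + g * b k + w)"
    using a_step[of k] \<open>0 \<le> l\<close> by (simp add: mult_left_mono)
  finally show "f * a (Suc k) + g * b (Suc k) \<le> l * (f * a k + g * b k + w)" .
qed

lemma cascade_decay_bound:
  fixes a b :: "nat \<Rightarrow> real"
  assumes nonneg: "\<And>k. 0 \<le> a k" "\<And>k. 0 \<le> b k" "0 \<le> f" "0 \<le> g" "0 \<le> w"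
    and "h \<le> 1" and l: "l = f + g * h" "0 < l" "l < 1"
    and a_step: "\<And>k. a (Suc k) \<le> f * a k + g * b k + w"
    and b_step: "\<And>k. b (Suc k) \<le> h * a (Suc k)"
  shows "a k + b k \<le> 2 * (f + g) / l * l ^ k * max (a 0) (b 0) + 2 / (1 - l) * w"
proof -
  let ?M = "max (a 0) (b 0)"
  have "f * a 0 + g * b 0 \<le> (f + g) * ?M"
    unfolding distrib_right using nonneg by (intro add_mono mult_left_mono) auto
  then have initial: "l ^ m * (f * a 0 + g * b 0) \<le> l ^ m * ((f + g) * ?M)" for m
    using \<open>0 < l\<close> by (simp add: mult_left_mono)
  have "a (Suc m) + b (Suc m) \<le> 2 * (l ^ m * ((f + g) * ?M) + l * w / (1 - l) + w)" for m
    using initial[of m] a_step[of m] order.trans[OF b_step mult_right_mono[OF \<open>h \<le> 1\<close> nonneg(1)], of m]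
      cascade_combination_bound[where a = a and b = b, OF \<open>0 \<le> g\<close> \<open>0 \<le> w\<close> l(1) less_imp_le[OF l(2)] l(3) a_step b_step, of m]
    by argo
  also have "\<dots> m = 2 * (f + g) / l * l ^ Suc m * ?M + 2 / (1 - l) * w" for m
    using \<open>0 < l\<close> \<open>l < 1\<close> by (simp add: field_simps)
  finally have "a (Suc m) + b (Suc m) \<le> 2 * (f + g) / l * l ^ Suc m * ?M + 2 / (1 - l) * w" for m .
  moreover have "l \<le> f + g"
    unfolding l(1) using \<open>0 \<le> g\<close> \<open>h \<le> 1\<close> by (simp add: mult_left_le)
  then have "2 \<le> 2 * (f + g) / l"
    using \<open>0 < l\<close> by (simp add: le_divide_eq)
  then have "a 0 + b 0 \<le> 2 * (f + g) / l * ?M"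
    using nonneg(1)[of 0] nonneg(2)[of 0] mult_right_mono[of 2 "2 * (f + g) / l" ?M] by linarith
  moreover have "0 \<le> 2 / (1 - l) * w"
    using \<open>l < 1\<close> \<open>0 \<le> w\<close> by simp
  ultimately show ?thesis
    by (cases k) auto
qed

lemma class_Kinf_linear:
  assumes "0 < c"
  shows "class_Kinf (\<lambda>s. c * s)"
  unfolding class_Kinf_def class_K_def
proof (intro conjI allI)
  show "continuous_on {0..} (\<lambda>s. c * s)"
    by (intro continuous_intros)
  show "strict_mono_on {0..} (\<lambda>s. c * s)"
    using assms by (auto simp: strict_mono_on_def)
  fix M :: real
  have "M < \<bar>M\<bar> + c"
    using assms by linarith
  also have "\<dots> = c * (\<bar>M\<bar> / c + 1)"
    using assms by (simp add: field_simps)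
  finally have "M < c * (\<bar>M\<bar> / c + 1)" .
  then show "\<exists>s\<ge>0. M < c * s"
    using assms by (intro exI[of _ "\<bar>M\<bar> / c + 1"]) auto
qed simp

lemma class_KL_exponential:
  assumes "0 < c" "0 < l" "l < 1"
  shows "class_KL (\<lambda>s k. c * l ^ k * s)"
  unfolding class_KL_def
proof (intro conjI allI impI)
  fix k
  show "class_K (\<lambda>s. c * l ^ k * s)"
    using class_Kinf_linear[of "c * l ^ k"] assms unfolding class_Kinf_def by simp
next
  fix s :: real and k1 k2 :: nat
  assume "0 < s" "k1 < k2"
  then show "c * l ^ k2 * s < c * l ^ k1 * s"
    using assms by (simp add: power_strict_decreasing)
next
  fix s :: real
  have "(\<lambda>k. c * l ^ k * s) \<longlonglongrightarrow> c * 0 * s"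
    using assms by (intro tendsto_intros LIMSEQ_power_zero) simp
  then show "(\<lambda>k. c * l ^ k * s) \<longlonglongrightarrow> 0"
    by simp
qed

lemma norm_le_SUP_of_input_set:
  fixes u :: "nat \<Rightarrow> real ^ 'u"
  assumes "\<forall>t. u t \<in> input_set umax"
  shows "norm (u t) \<le> (SUP h. norm (u h))"
proof (rule cSUP_upper[OF UNIV_I], rule bdd_aboveI2)
  fix h
  have "norm (u h) \<le> (\<Sum>j\<in>UNIV. \<bar>u h $ j\<bar>)"
    by (rule norm_le_l1_cart)
  also have "\<dots> \<le> of_nat CARD('u) * umax"
    using assms sum_bounded_above[of UNIV "\<lambda>j. \<bar>u h $ j\<bar>" umax] by (simp add: input_set_def)
  finally show "norm (u h) \<le> of_nat CARD('u) * umax" .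
qed

lemma affine_component_le_inf_norm_concat:
  fixes W :: "real ^ 'u ^ 'x" and U :: "real ^ 'x ^ 'x"
  assumes "u \<in> input_set umax" and "\<forall>k. \<bar>\<xi> $ k\<bar> \<le> 1"
  shows "(W *v u + U *v \<xi> + b) $ j \<le> inf_norm_concat W umax U b"
proof -
  have "\<bar>(W *v u) $ j\<bar> \<le> (\<Sum>k\<in>UNIV. \<bar>W $ j $ k * u $ k\<bar>)"
    unfolding matrix_vector_mult_def by simp
  also have "\<dots> \<le> (\<Sum>k\<in>UNIV. \<bar>W $ j $ k * umax\<bar>)"
    using assms(1) unfolding input_set_def
    by (intro sum_mono) (auto simp: abs_mult intro!: mult_left_mono intro: order_trans[OF _ abs_ge_self])
  finally have Wu: "\<bar>(W *v u) $ j\<bar> \<le> (\<Sum>k\<in>UNIV. \<bar>W $ j $ k * umax\<bar>)" .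
  have "\<bar>(U *v \<xi>) $ j\<bar> \<le> (\<Sum>k\<in>UNIV. \<bar>U $ j $ k * \<xi> $ k\<bar>)"
    unfolding matrix_vector_mult_def by simp
  also have "\<dots> \<le> (\<Sum>k\<in>UNIV. \<bar>U $ j $ k\<bar>)"
    using assms(2) by (intro sum_mono) (simp add: abs_mult mult_left_le)
  finally have U\<xi>: "\<bar>(U *v \<xi>) $ j\<bar> \<le> (\<Sum>k\<in>UNIV. \<bar>U $ j $ k\<bar>)" .
  have "(W *v u + U *v \<xi> + b) $ j
      \<le> (\<Sum>k\<in>UNIV. \<bar>W $ j $ k * umax\<bar>) + (\<Sum>k\<in>UNIV. \<bar>U $ j $ k\<bar>) + \<bar>b $ j\<bar>"
    using Wu U\<xi> by simp
  also have "\<dots> \<le> inf_norm_concat W umax U b"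
    unfolding inf_norm_concat_def by (rule Max_ge) auto
  finally show ?thesis .
qed

lemma norm_sigmoid_gate_le:
  assumes "u \<in> input_set umax" and "\<forall>k. \<bar>\<xi> $ k\<bar> \<le> 1"
  shows "norm (vmap sigmoid (W *v u + U *v \<xi> + b) \<circ>\<^sub>H v)
    \<le> sigmoid (inf_norm_concat W umax U b) * norm v"
  by (rule norm_hadamard_le)
    (use affine_component_le_inf_norm_concat[OF assms] sigmoid_pos in
      \<open>simp add: vmap_def sigmoid_mono less_imp_le\<close>)

lemma fst_lstm_step:
  "fst (lstm_step N u s) =
     vmap sigmoid (Wf N *v u + Uf N *v snd s + bf N) \<circ>\<^sub>H fst s
     + vmap sigmoid (Wi N *v u + Ui N *v snd s + bi N) \<circ>\<^sub>H vmap tanh (Wc N *v u + Uc N *v snd s + bc N)"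
  by (simp add: lstm_step_def Let_def)

lemma snd_lstm_step:
  "snd (lstm_step N u s) =
     vmap sigmoid (Wo N *v u + Uo N *v snd s + bo N) \<circ>\<^sub>H vmap tanh (fst (lstm_step N u s))"
  by (simp add: lstm_step_def Let_def)

lemma abs_snd_lstm_step_less_1: "\<bar>snd (lstm_step N u s) $ j\<bar> < 1"
proof -
  have "\<bar>sigmoid p * tanh q\<bar> < 1" for p q
  proof -
    have "\<bar>sigmoid p\<bar> < 1" "\<bar>tanh q\<bar> < 1"
      using sigmoid_pos[of p] sigmoid_less_1[of p] tanh_real_lt_1[of q] tanh_real_gt_neg1[of q]
      by auto
    then show ?thesis
      by (metis abs_mult abs_mult_less mult_1)
  qed
  then show ?thesis
    unfolding snd_lstm_step by (simp add: hadamard_def vmap_def)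
qed

lemma abs_snd_lstm_traj_less_1:
  assumes "\<chi>0 \<in> state_set N umax"
  shows "\<bar>snd (lstm_traj N u \<chi>0 k) $ j\<bar> < 1"
proof (cases k)
  case 0
  with assms show ?thesis
    by (auto simp: state_set_def abs_less_iff)
next
  case (Suc m)
  then show ?thesis
    by (simp add: abs_snd_lstm_step_less_1)
qed

lemma sbar_bounds:
  "0 < sbar_f N umax" "sbar_f N umax < 1" "0 < sbar_i N umax" "sbar_i N umax < 1"
  "0 < sbar_o N umax" "sbar_o N umax < 1"
  unfolding sbar_f_def sbar_i_def sbar_o_def by (simp_all add: sigmoid_pos sigmoid_less_1)

lemma norm_fst_lstm_step_le:
  assumes "u \<in> input_set umax" and "\<forall>j. \<bar>snd s $ j\<bar> \<le> 1" and "norm u \<le> S"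
  shows "norm (fst (lstm_step N u s)) \<le> sbar_f N umax * norm (fst s)
    + sbar_i N umax * mat_norm2 (Uc N) * norm (snd s) + sbar_i N umax * (mat_norm2 (Wc N) * S + norm (bc N))"
proof -
  let ?c = "Wc N *v u + Uc N *v snd s + bc N"
  have "norm ?c \<le> norm (Wc N *v u) + norm (Uc N *v snd s) + norm (bc N)"
    by (meson add_right_mono norm_triangle_ineq order.trans)
  also have "\<dots> \<le> mat_norm2 (Wc N) * S + mat_norm2 (Uc N) * norm (snd s) + norm (bc N)"
    using norm_matrix_vector_mult_le[of "Wc N" u] mult_left_mono[OF assms(3) mat_norm2_nonneg[of "Wc N"]]
    by (intro add_mono norm_matrix_vector_mult_le order.refl) linarith
  finally have c: "norm (vmap tanh ?c) \<le> mat_norm2 (Wc N) * S + mat_norm2 (Uc N) * norm (snd s) + norm (bc N)"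
    using norm_vmap_tanh_le order.trans by blast
  have "norm (fst (lstm_step N u s))
      \<le> sbar_f N umax * norm (fst s) + sbar_i N umax * norm (vmap tanh ?c)"
    unfolding fst_lstm_step sbar_f_def sbar_i_def
    by (intro order.trans[OF norm_triangle_ineq] add_mono norm_sigmoid_gate_le assms(1,2))
  also have "\<dots> \<le> sbar_f N umax * norm (fst s)
      + sbar_i N umax * (mat_norm2 (Wc N) * S + mat_norm2 (Uc N) * norm (snd s) + norm (bc N))"
    using c less_imp_le[OF sbar_bounds(3)] by (intro add_left_mono mult_left_mono)
  finally show ?thesis
    by (simp add: algebra_simps)
qed

lemma norm_snd_lstm_step_le:
  assumes "u \<in> input_set umax" and "\<forall>j. \<bar>snd s $ j\<bar> \<le> 1"
  shows "norm (snd (lstm_step N u s)) \<le> sbar_o N umax * norm (fst (lstm_step N u s))"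
proof -
  have "norm (snd (lstm_step N u s)) \<le> sbar_o N umax * norm (vmap tanh (fst (lstm_step N u s)))"
    unfolding snd_lstm_step sbar_o_def by (rule norm_sigmoid_gate_le[OF assms])
  also have "\<dots> \<le> sbar_o N umax * norm (fst (lstm_step N u s))"
    using norm_vmap_tanh_le less_imp_le[OF sbar_bounds(5)] by (rule mult_left_mono)
  finally show ?thesis .
qed

definition lstm_rate :: "('u::finite, 'x::finite) lstm \<Rightarrow> real \<Rightarrow> real" where
  "lstm_rate N umax = sbar_f N umax + sbar_o N umax * sbar_i N umax * mat_norm2 (Uc N)"

lemma lstm_rate_pos: "0 < lstm_rate N umax"
  unfolding lstm_rate_def using sbar_bounds[of N umax] mat_norm2_nonneg[of "Uc N"]
  by (intro add_pos_nonneg mult_nonneg_nonneg) auto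

lemma spectral_radius_iss_matrix: "spectral_radius (iss_matrix N umax) = lstm_rate N umax"
  using spectral_radius_rank_one_2x2[of "sbar_f N umax" "sbar_i N umax * mat_norm2 (Uc N)" "sbar_o N umax"]
    lstm_rate_pos[of N umax]
  unfolding iss_matrix_def lstm_rate_def by (simp add: mult.assoc)

lemma norm_lstm_traj_le:
  fixes N :: "('u::finite, 'x::finite) lstm"
  assumes rate: "lstm_rate N umax < 1" and "\<chi>0 \<in> state_set N umax"
    and "\<And>t. u t \<in> input_set umax" and "\<And>t. norm (u t) \<le> S"
  shows "norm (lstm_traj N u \<chi>0 k)
    \<le> 2 * (sbar_f N umax + sbar_i N umax * mat_norm2 (Uc N)) / lstm_rate N umax
        * lstm_rate N umax ^ k * norm \<chi>0
      + 2 / (1 - lstm_rate N umax) * sbar_i N umax * (mat_norm2 (Wc N) * S + norm (bc N))"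
proof -
  let ?l = "lstm_rate N umax" and ?f = "sbar_f N umax" and ?i = "sbar_i N umax"
  let ?g = "?i * mat_norm2 (Uc N)" and ?w = "?i * (mat_norm2 (Wc N) * S + norm (bc N))"
  define a where "a k = norm (fst (lstm_traj N u \<chi>0 k))" for k
  define b where "b k = norm (snd (lstm_traj N u \<chi>0 k))" for k
  have hidden: "\<forall>j. \<bar>snd (lstm_traj N u \<chi>0 k) $ j\<bar> \<le> 1" for k
    using abs_snd_lstm_traj_less_1[OF assms(2)] less_imp_le by blast
  have "0 \<le> S"
    using assms(4)[of 0] norm_ge_zero order_trans by blast
  note nonneg = sbar_bounds[of N umax] mat_norm2_nonneg[of "Uc N"] mat_norm2_nonneg[of "Wc N"] \<open>0 \<le> S\<close>
  have "a k + b k \<le> 2 * (?f + ?g) / ?l * ?l ^ k * max (a 0) (b 0) + 2 / (1 - ?l) * ?w"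
  proof (rule cascade_decay_bound[where h = "sbar_o N umax"])
    show "a (Suc k) \<le> ?f * a k + ?g * b k + ?w" for k
      using norm_fst_lstm_step_le[OF assms(3) hidden assms(4)] unfolding a_def b_def by simp
    show "b (Suc k) \<le> sbar_o N umax * a (Suc k)" for k
      using norm_snd_lstm_step_le[OF assms(3) hidden] unfolding a_def b_def by simp
  qed (use nonneg rate lstm_rate_pos in \<open>auto simp: a_def b_def lstm_rate_def less_imp_le\<close>)
  moreover have "norm (lstm_traj N u \<chi>0 k) \<le> a k + b k"
    unfolding a_def b_def by (metis norm_Pair_le prod.collapse)
  moreover have "max (a 0) (b 0) \<le> norm \<chi>0"
    unfolding a_def b_def lstm_traj.simps by (metis max.boundedI norm_fst_le norm_snd_le prod.collapse)
  moreover have "0 \<le> 2 * (?f + ?g) / ?l * ?l ^ k"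
    using nonneg lstm_rate_pos[of N umax] by (simp add: less_imp_le)
  ultimately have "norm (lstm_traj N u \<chi>0 k)
    \<le> 2 * (?f + ?g) / ?l * ?l ^ k * norm \<chi>0 + 2 / (1 - ?l) * ?w"
    by (meson add_right_mono mult_left_mono order_trans)
  then show ?thesis
    by (simp add: mult.assoc)
qed

theorem theorem1:
  fixes N :: "('u::finite, 'x::finite) lstm" and umax :: real
  assumes "spectral_radius (iss_matrix N umax) < 1"
  shows "\<exists>\<beta> \<gamma>v \<gamma>b. class_KL \<beta> \<and> class_Kinf \<gamma>v \<and> class_Kinf \<gamma>b \<and>
    (\<forall>k \<chi>0 u. \<chi>0 \<in> state_set N umax \<longrightarrow> (\<forall>t. u t \<in> input_set umax) \<longrightarrow>
       norm (lstm_traj N u \<chi>0 k)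
         \<le> \<beta> (norm \<chi>0) k + \<gamma>v (SUP h. norm (u h)) + \<gamma>b (norm (bc N)))"
proof -
  define l where "l = lstm_rate N umax"
  define c where "c = 2 * (sbar_f N umax + sbar_i N umax * mat_norm2 (Uc N)) / l"
  define Q where "Q = 2 / (1 - l) * sbar_i N umax"
  define K where "K = mat_norm2 (Wc N)"
  have l: "0 < l" "l < 1"
    using assms lstm_rate_pos unfolding l_def spectral_radius_iss_matrix by auto
  have "0 < c" "0 < Q" "0 \<le> K"
    unfolding c_def Q_def K_def using l sbar_bounds[of N umax] mat_norm2_nonneg[of "Uc N"]
    by (auto intro!: divide_pos_pos add_pos_nonneg simp: mat_norm2_nonneg)
  show ?thesis
  proof (intro exI conjI allI impI)
    show "class_KL (\<lambda>s k. c * l ^ k * s)"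
      using class_KL_exponential \<open>0 < c\<close> l by blast
    show "class_Kinf (\<lambda>s. (Q * K + 1) * s)" "class_Kinf (\<lambda>s. Q * s)"
      \<comment> \<open>K = \<parallel>Wc\<parallel> may vanish; the + 1 keeps the input gain strictly increasing\<close>
      using \<open>0 < Q\<close> \<open>0 \<le> K\<close> by (auto intro!: class_Kinf_linear add_nonneg_pos)
    fix k :: nat and \<chi>0 :: "(real ^ 'x) \<times> (real ^ 'x)" and u :: "nat \<Rightarrow> real ^ 'u"
    assume "\<chi>0 \<in> state_set N umax" and u: "\<forall>t. u t \<in> input_set umax"
    let ?S = "SUP h. norm (u h)"
    have S: "norm (u t) \<le> ?S" for t
      using u by (rule norm_le_SUP_of_input_set)
    then have "0 \<le> ?S"
      using norm_ge_zero order_trans by blast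
    have "norm (lstm_traj N u \<chi>0 k) \<le> c * l ^ k * norm \<chi>0 + Q * (K * ?S + norm (bc N))"
      using norm_lstm_traj_le[OF l(2)[unfolded l_def] \<open>\<chi>0 \<in> state_set N umax\<close> u[rule_format] S]
      unfolding c_def Q_def K_def l_def .
    also have "\<dots> \<le> c * l ^ k * norm \<chi>0 + (Q * K + 1) * ?S + Q * norm (bc N)"
      using \<open>0 \<le> ?S\<close> by (simp add: algebra_simps)
    finally show "norm (lstm_traj N u \<chi>0 k) \<le> c * l ^ k * norm \<chi>0 + (Q * K + 1) * ?S + Q * norm (bc N)" .
  qed
qed

end
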